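(* Let $d\ge 2$, let $D\subset[0,1]^d$ be a strictly convex open set with $\overline D\subset(0,1)^d$, and let $f\colon [0,1]^d\setminus D\to\mathbb{R}$ be bounded. Let $(r_n)$ be a sequence of positive numbers decreasing to $0$ such that $$\frac{\sqrt{n}\, r_n^{2d}}{\log n}\longrightarrow +\infty\quad (n\to\infty),\qquad \text{and let}\quad \delta_n=\frac{r_n}{\sqrt{\log n}} .$$ Then, $\mathbb{P}$-almost surely, for all $n$ sufficiently large, the game value $u_n\colon \mathcal{C}_n\to\mathbb{R}$ is the unique function $u\colon\mathcal{C}_n\to\mathbb{R}$ satisfying the Dynamic Programming Principle $$\begin{cases} u(x)=\min\limits_{y\in\mathcal{N}_x^{\delta_n}}\left(\tfrac12 u(y)+\tfrac12 u(y_x)\right), & x\in\mathcal{D}_n,\\ u(x)=f(x), & x\in\mathcal{B}_n.\end{cases}$$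
   Context: Random graph. $(X_n)_{n\in\mathbb{N}}$ are independent random variables uniform on $[0,1]^d$; $\mathbb{P}$ is the product measure on $\Omega=([0,1]^d)^{\mathbb{N}}$. Set $\chi_n=\{X_1,\dots,X_n\}$. The graph $\mathcal{G}_n$ has vertex set $\chi_n$, and distinct $x,y\in\chi_n$ are adjacent ($x\sim y$) iff $|x-y|<r_n$ (Euclidean norm). $\mathcal{C}_n$ denotes the largest connected component of $\mathcal{G}_n$ (its vertex set), $\mathcal{D}_n=\mathcal{C}_n\cap D$, $\mathcal{B}_n=\mathcal{C}_n\cap([0,1]^d\setminus D)$. For $x\in\chi_n$, $\mathcal{N}_x=\{y\in\chi_n: y\sim x\}$ and $\mathcal{N}_x^{\delta_n}=\{y\in\mathcal{N}_x: |x-y|>(1-\delta_n)r_n\}$. When $\mathcal{N}_x^{\delta_n}\ne\emptyset$ and $y\in\mathcal{N}_x^{\delta_n}$, the approximate reflection of $y$ with respect to $x$ is $y_x=A_x(y)=\operatorname{argmin}\{|z+y-2x|^2: z\in\mathcal{N}_x^{\delta_n}\}$ (ties, of probability zero, are broken by lexicographic order). $\mathbb{P}$-almost surely, for $n$ large, $\mathcal{N}_x^{\delta_n}\neq\emptyset$ for all $x\in\mathcal{C}_n$, so that the game below is well defined. Game (for a fixed realization of the graph). A strategy $S=(S_n^k)_{k\ge0}$ assigns to each partial history $(x_0,\dots,x_k)$ of positions a point $S_n^k(x_0,\dots,x_k)\in\mathcal{N}_{x_k}^{\delta_n}$. Given $x_0$ and $S$, $P_{S,n}^{x_0}$ is the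 law of the sequence of positions started at $x_0$ such that, conditionally on $(x_0,\dots,x_k)$, the next position $x_{k+1}$ equals $S_n^k(x_0,\dots,x_k)$ with probability $1/2$ and $A_{x_k}(S_n^k(x_0,\dots,x_k))$ with probability $1/2$; $E_{S,n}^{x_0}$ is the corresponding expectation. Let $\tau=\inf\{k\ge0: x_k\in\mathcal{B}_n\}$. The game value is $u_n(x_0)=\inf_S E_{S,n}^{x_0}[f(x_\tau)]$, where the infimum is over all strategies; for $x_0\in\mathcal{B}_n$ one has $\tau=0$ and $u_n(x_0)=f(x_0)$. ($\mathbb{P}$-almost surely, for $n$ large, $\tau<\infty$ $P_{S,n}^{x_0}$-almost surely for every $x_0$ and $S$.) *)

theory Defs
  imports "HOL-Probability.Probability" "HOL-Library.Fun_Lexorder"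
begin

text \<open>
  The space \<open>\<real>\<^sup>d\<close> is \<^typ>\<open>real ^ 'd\<close> with \<^typ>\<open>'d\<close> finite; a linear order on the index type is
  needed only for the lexicographic order on points. The unit cube is \<open>cbox 0 1\<close>.
\<close>

type_synonym 'd point = "(real, 'd) vec"

definition strictly_convex_set :: "'a::euclidean_space set \<Rightarrow> bool" where
  "strictly_convex_set S \<longleftrightarrow>
     (\<forall>x\<in>closure S. \<forall>y\<in>closure S. x \<noteq> y \<longrightarrow> open_segment x y \<subseteq> interior S)"


subsection \<open>The random geometric graph\<close>

definition sample_space :: "(nat \<Rightarrow> 'd::finite point) measure" where
  "sample_space = PiM UNIV (\<lambda>_. restrict_space lborel (cbox 0 1))"

definition points :: "(nat \<Rightarrow> 'a) \<Rightarrow> nat \<Rightarrow> 'a set" where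
  "points X n = X ` {1..n}"

definition adj_rel :: "'a::real_normed_vector set \<Rightarrow> real \<Rightarrow> ('a \<times> 'a) set" where
  "adj_rel V r = {(x, y). x \<in> V \<and> y \<in> V \<and> x \<noteq> y \<and> norm (x - y) < r}"

text \<open>
  The adjacency relation is symmetric, so its reflexive transitive closure is an equivalence relation
  and the quotient of the vertex set is the set of connected components. If several components have
  maximal size, \<^const>\<open>arg_max\<close> selects an arbitrary one of them.
\<close>

definition largest_component :: "'a::real_normed_vector set \<Rightarrow> real \<Rightarrow> 'a set" where
  "largest_component V r = arg_max card (\<lambda>C. C \<in> V // (adj_rel V r)\<^sup>*)"

definition neighbours :: "'a::real_normed_vector set \<Rightarrow> real \<Rightarrow> 'a \<Rightarrow> 'a set" where
  "neighbours V r x = {y. (x, y) \<in> adj_rel V r}"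

definition far_neighbours :: "'a::real_normed_vector set \<Rightarrow> real \<Rightarrow> real \<Rightarrow> 'a \<Rightarrow> 'a set" where
  "far_neighbours V r \<delta> x = {y \<in> neighbours V r x. norm (x - y) > (1 - \<delta>) * r}"

text \<open>Among several minimisers, the lexicographically smallest one is taken.\<close>

definition reflection ::
    "'d::{finite,linorder} point set \<Rightarrow> real \<Rightarrow> real \<Rightarrow> 'd point \<Rightarrow> 'd point \<Rightarrow> 'd point" where
  "reflection V r \<delta> x y =
     (let minimiser = is_arg_min (\<lambda>z. (norm (z + y - 2 *\<^sub>R x))\<^sup>2) (\<lambda>z. z \<in> far_neighbours V r \<delta> x)
      in THE z. minimiser z \<and> (\<forall>w. minimiser w \<longrightarrow> w = z \<or> less_fun (($) z) (($) w)))"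

definition interior_vertices ::
    "'a::real_normed_vector set \<Rightarrow> real \<Rightarrow> 'a set \<Rightarrow> 'a set" where
  "interior_vertices V r D = largest_component V r \<inter> D"

definition boundary_vertices ::
    "'d::finite point set \<Rightarrow> real \<Rightarrow> 'd point set \<Rightarrow> 'd point set" where
  "boundary_vertices V r D = largest_component V r \<inter> (cbox 0 1 - D)"


subsection \<open>The game\<close>

text \<open>
  A partial history \<open>(x\<^sub>0, \<dots>, x\<^sub>k)\<close> is the nonempty list \<open>[x\<^sub>0, \<dots>, x\<^sub>k]\<close>. Since \<open>k\<close> is determined by
  its length, a strategy \<open>(S\<^sup>k)\<close> is a single function on lists.
\<close>

definition strategies ::
    "'a::real_normed_vector set \<Rightarrow> real \<Rightarrow> real \<Rightarrow> ('a list \<Rightarrow> 'a) set" where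
  "strategies V r \<delta> =
     {S. \<forall>h. h \<noteq> [] \<and> set h \<subseteq> largest_component V r \<longrightarrow> S h \<in> far_neighbours V r \<delta> (last h)}"

text \<open>
  The law of the game is realised by independent fair coins \<open>c 0, c 1, \<dots>\<close>: from the history \<open>h\<close>
  of length \<open>k + 1\<close>, the token moves to \<open>S h\<close> if \<open>c k\<close> holds and to the approximate reflection
  of \<open>S h\<close> with respect to \<open>last h\<close> otherwise.
\<close>

primrec history ::
    "'d::{finite,linorder} point set \<Rightarrow> real \<Rightarrow> real \<Rightarrow> ('d point list \<Rightarrow> 'd point) \<Rightarrow> 'd point \<Rightarrow>
     (nat \<Rightarrow> bool) \<Rightarrow> nat \<Rightarrow> 'd point list" where
  "history V r \<delta> S x0 c 0 = [x0]"
| "history V r \<delta> S x0 c (Suc k) =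
     (let h = history V r \<delta> S x0 c k
      in h @ [if c k then S h else reflection V r \<delta> (last h) (S h)])"

definition coins :: "(nat \<Rightarrow> bool) measure" where
  "coins = PiM UNIV (\<lambda>_. measure_pmf (bernoulli_pmf (1/2)))"

definition game_law ::
    "'d::{finite,linorder} point set \<Rightarrow> real \<Rightarrow> real \<Rightarrow> ('d point list \<Rightarrow> 'd point) \<Rightarrow> 'd point \<Rightarrow>
     (nat \<Rightarrow> 'd point) measure" where
  "game_law V r \<delta> S x0 =
     distr coins (PiM UNIV (\<lambda>_. count_space UNIV)) (\<lambda>c k. last (history V r \<delta> S x0 c k))"

text \<open>
  The pay-off \<open>f (x\<^sub>\<tau>)\<close> for \<open>\<tau> = inf {k. x\<^sub>k \<in> B}\<close>; the value on the event \<open>\<tau> = \<infinity>\<close> is a mere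
  convention, used only to make the function total.
\<close>

definition payoff :: "'a set \<Rightarrow> ('a \<Rightarrow> real) \<Rightarrow> (nat \<Rightarrow> 'a) \<Rightarrow> real" where
  "payoff B f x = (if \<exists>k. x k \<in> B then f (x (LEAST k. x k \<in> B)) else 0)"

definition game_value ::
    "'d::{finite,linorder} point set \<Rightarrow> real \<Rightarrow> real \<Rightarrow> 'd point set \<Rightarrow> ('d point \<Rightarrow> real) \<Rightarrow>
     'd point \<Rightarrow> real" where
  "game_value V r \<delta> D f x0 =
     (INF S\<in>strategies V r \<delta>. \<integral>x. payoff (boundary_vertices V r D) f x \<partial>game_law V r \<delta> S x0)"


subsection \<open>The Dynamic Programming Principle\<close>

text \<open>
  As \<^const>\<open>Min\<close> of the empty set is unspecified, nonemptiness is stated explicitly: a minimum over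
  the empty set does not exist. Only the values of \<open>u\<close> on the largest component matter.
\<close>

definition satisfies_DPP ::
    "'d::{finite,linorder} point set \<Rightarrow> real \<Rightarrow> real \<Rightarrow> 'd point set \<Rightarrow> ('d point \<Rightarrow> real) \<Rightarrow>
     ('d point \<Rightarrow> real) \<Rightarrow> bool" where
  "satisfies_DPP V r \<delta> D f u \<longleftrightarrow>
     (\<forall>x\<in>interior_vertices V r D.
        far_neighbours V r \<delta> x \<noteq> {} \<and>
        u x = Min ((\<lambda>y. 1/2 * u y + 1/2 * u (reflection V r \<delta> x y)) ` far_neighbours V r \<delta> x)) \<and>
     (\<forall>x\<in>boundary_vertices V r D. u x = f x)"

end

theory Submission
  imports Defs "HOL-Real_Asymp.Real_Asymp"
begin

text \<open>
  Every solution of the Dynamic Programming Principle is compared with the expected cost of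
  an arbitrary strategy by a maximum principle, where strict monotonicity along the game comes
  from \<open>|x|\<^sup>2\<close>: a point \<open>y\<close> and its approximate reflection \<open>y\<^sub>x\<close> satisfy \<open>|y|\<^sup>2 + |y\<^sub>x|\<^sup>2 > 2 |x|\<^sup>2\<close>
  as soon as the reflection error is small compared to \<open>r\<^sub>n\<^sup>2\<close>, so one of the two successors is
  further away from the origin. Hence no separate proof that the game terminates is needed. A greedy
  strategy attains equality, and a solution exists by monotone iteration. The reflection error is
  at most \<open>\<delta>\<^sub>n r\<^sub>n\<close>, which is \<open>r\<^sub>n\<^sup>2\<close> over \<open>sqrt (log n)\<close>, whenever each point of the cube has a vertex
  within distance \<open>\<delta>\<^sub>n r\<^sub>n / 2\<close>. By Borel-Cantelli this holds almost surely for all large \<open>n\<close>,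
  because a suitable grid of mesh below that scale has no empty cell.
\<close>

section \<open>Graph vertices and reflections\<close>

lemma far_neighbours_subset: "far_neighbours V r \<delta> x \<subseteq> V"
  by (auto simp: far_neighbours_def neighbours_def adj_rel_def)

text \<open>\<open>arg_max\<close> yields a genuine maximiser only if the sizes are bounded. There
  are finitely many classes, and \<open>Suc (Max ...)\<close> is the strict bound that
  \<open>arg_max_natI\<close> asks for.\<close>

lemma largest_component_class:
  assumes "finite V" "V \<noteq> {}"
  obtains x where "x \<in> V" "largest_component V r = (adj_rel V r)\<^sup>* `` {x}"
proof -
  let ?Q = "V // (adj_rel V r)\<^sup>*"
  have fin: "finite ?Q"
    using assms by (simp add: quotient_def)
  obtain x where "x \<in> V" using assms by auto
  then have mem: "(adj_rel V r)\<^sup>* `` {x} \<in> ?Q" by (rule quotientI)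
  have "\<forall>y. y \<in> ?Q \<longrightarrow> card y < Suc (Max (card ` ?Q))"
    using fin by (auto simp: less_Suc_eq_le)
  with mem have "largest_component V r \<in> ?Q"
    unfolding largest_component_def by (rule arg_max_natI)
  then show ?thesis using that by (auto elim!: quotientE)
qed

lemma largest_component_subset:
  assumes "finite V" "V \<noteq> {}"
  shows "largest_component V r \<subseteq> V"
proof -
  obtain x where x: "x \<in> V" "largest_component V r = (adj_rel V r)\<^sup>* `` {x}"
    using largest_component_class[OF assms] by blast
  have "y \<in> V" if "(x, y) \<in> (adj_rel V r)\<^sup>*" for y
    using that x(1) by (induction rule: rtrancl_induct) (auto simp: adj_rel_def)
  then show ?thesis using x by auto
qed

text \<open>Far neighbours are joined to \<open>x\<close> by an edge, so play never leaves the
  component.\<close>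

lemma far_neighbours_largest_component:
  assumes "finite V" "V \<noteq> {}" "x \<in> largest_component V r"
  shows "far_neighbours V r \<delta> x \<subseteq> largest_component V r"
proof -
  obtain z where "largest_component V r = (adj_rel V r)\<^sup>* `` {z}"
    using largest_component_class[OF assms(1,2)] by blast
  then show ?thesis
    using assms(3) by (auto simp: far_neighbours_def neighbours_def intro: rtrancl_into_rtrancl)
qed

text \<open>Makes the \<open>THE\<close> in \<open>reflection\<close> well defined: the
  lexicographic order on points is total, so a least element is found by induction on the set, and
  asymmetry makes it unique.\<close>

lemma vec_lex_least_exists:
  fixes M :: "'d::{finite,linorder} point set"
  assumes "finite M" "M \<noteq> {}"
  shows "\<exists>!z. z \<in> M \<and> (\<forall>w\<in>M. w = z \<or> less_fun (($) z) (($) w))"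
proof -
  have tri: "less_fun (($) z) (($) w) \<or> z = w \<or> less_fun (($) w) (($) z)" for z w :: "'d point"
    using less_fun_trichotomy[of "($) z" "($) w"] by (auto simp: vec_eq_iff fun_eq_iff)
  have "\<exists>z\<in>M. \<forall>w\<in>M. w = z \<or> less_fun (($) z) (($) w)"
    using assms
  proof (induction rule: finite_ne_induct)
    case (insert x F)
    then obtain z where z: "z \<in> F" "\<forall>w\<in>F. w = z \<or> less_fun (($) z) (($) w)" by blast
    consider "less_fun (($) z) (($) x)" | "z = x" | "less_fun (($) x) (($) z)" using tri by blast
    then show ?case
    proof cases
      case 3
      then have "\<forall>w\<in>insert x F. w = x \<or> less_fun (($) x) (($) w)"
        using z by (auto intro: less_fun_trans)
      then show ?thesis by blast
    qed (use z in auto)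
  qed auto
  then obtain z where z: "z \<in> M" "\<forall>w\<in>M. w = z \<or> less_fun (($) z) (($) w)" by blast
  show ?thesis
  proof (rule ex1I[of _ z])
    fix w assume w: "w \<in> M \<and> (\<forall>v\<in>M. v = w \<or> less_fun (($) w) (($) v))"
    show "w = z"
    proof (rule ccontr)
      assume "w \<noteq> z"
      then have "less_fun (($) z) (($) w)" "less_fun (($) w) (($) z)" using z w by auto
      then show False using less_fun_asym by blast
    qed
  qed (use z in simp)
qed

text \<open>By finiteness the minimisers form a finite nonempty set, from which the lexicographic
  rule picks one; \<open>y\<close> is arbitrary.\<close>

lemma reflection_is_arg_min:
  assumes "finite V" "far_neighbours V r \<delta> x \<noteq> {}"
  shows "is_arg_min (\<lambda>z. (norm (z + y - 2 *\<^sub>R x))\<^sup>2) (\<lambda>z. z \<in> far_neighbours V r \<delta> x)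
           (reflection V r \<delta> x y)"
proof -
  let ?N = "far_neighbours V r \<delta> x"
  let ?P = "is_arg_min (\<lambda>z. (norm (z + y - 2 *\<^sub>R x))\<^sup>2) (\<lambda>z. z \<in> ?N)"
  have fin: "finite ?N" using finite_subset[OF far_neighbours_subset assms(1)] .
  have ne: "Collect ?P \<noteq> {}"
    using ex_is_arg_min_if_finite[OF fin assms(2)] by blast
  have "Collect ?P \<subseteq> ?N" by (auto simp: is_arg_min_def)
  then have "finite (Collect ?P)" using fin by (rule finite_subset)
  then have "\<exists>!z. ?P z \<and> (\<forall>w. ?P w \<longrightarrow> w = z \<or> less_fun (($) z) (($) w))"
    using vec_lex_least_exists[OF _ ne] by simp
  from theI'[OF this, THEN conjunct1] show ?thesis
    unfolding reflection_def Let_def .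
qed

lemma reflection_in_far_neighbours:
  assumes "finite V" "far_neighbours V r \<delta> x \<noteq> {}"
  shows "reflection V r \<delta> x y \<in> far_neighbours V r \<delta> x"
  using reflection_is_arg_min[OF assms] by (simp add: is_arg_min_def)

lemma reflection_minimal:
  assumes "finite V" "z \<in> far_neighbours V r \<delta> x"
  shows "norm (reflection V r \<delta> x y + y - 2 *\<^sub>R x) \<le> norm (z + y - 2 *\<^sub>R x)"
proof -
  have "(norm (reflection V r \<delta> x y + y - 2 *\<^sub>R x))\<^sup>2 \<le> (norm (z + y - 2 *\<^sub>R x))\<^sup>2"
    using reflection_is_arg_min[of V r \<delta> x y] assms by (auto simp: is_arg_min_linorder)
  then show ?thesis by (simp add: power2_le_iff_abs_le)
qed


section \<open>First-step analysis of the game\<close>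

lemma history_neq_Nil [simp]: "history V r \<delta> S x c k \<noteq> []"
  by (cases k) (auto simp: Let_def)

text \<open>The game restarts after its first move: the continuation strategy remembers the initial
  point, and the coins are shifted by one.\<close>

lemma history_Suc_shift:
  "history V r \<delta> S x c (Suc k) =
     x # history V r \<delta> (\<lambda>h. S (x # h)) (if c 0 then S [x] else reflection V r \<delta> x (S [x]))
           (\<lambda>i. c (Suc i)) k"
proof (induction k)
  case (Suc k)
  show ?case
    unfolding history.simps(2)[of V r \<delta> S x c "Suc k"] Suc.IH by (simp add: Let_def)
qed (simp add: Let_def)

text \<open>On paths that never reach \<open>B\<close> both sides are the default value 0.\<close>

lemma payoff_shift:
  "payoff B f p = (if p 0 \<in> B then f (p 0) else payoff B f (\<lambda>k. p (Suc k)))"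
proof (cases "p 0 \<in> B")
  case True
  then have "(LEAST k. p k \<in> B) = 0" by (intro Least_equality) auto
  then show ?thesis using True by (auto simp: payoff_def)
next
  case False
  have "(\<exists>k. p k \<in> B) \<longleftrightarrow> (\<exists>k. p (Suc k) \<in> B)"
    using False by (metis not0_implies_Suc)
  moreover have "(LEAST k. p k \<in> B) = Suc (LEAST k. p (Suc k) \<in> B)" if "p k \<in> B" for k
    by (rule Least_Suc[OF that False])
  ultimately show ?thesis using False by (auto simp: payoff_def)
qed

text \<open>Also true when \<open>B\<close> is never reached, because the default value is 0. Upper
  bounds on costs thus follow from lower bounds for \<open>- f\<close>.\<close>

lemma payoff_uminus: "payoff B (\<lambda>x. - f x) p = - payoff B f p"
  by (simp add: payoff_def)

lemma payoff_abs_le: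
  assumes "\<And>x. x \<in> B \<Longrightarrow> \<bar>f x\<bar> \<le> F" "0 \<le> F"
  shows "\<bar>payoff B f p\<bar> \<le> F"
  unfolding payoff_def using assms by (auto intro: assms(1) LeastI)

lemma payoff_measurable [measurable]:
  "payoff B f \<in> borel_measurable (PiM UNIV (\<lambda>_. count_space UNIV))"
proof -
  have [measurable]: "Measurable.pred (count_space UNIV) (\<lambda>x. x \<in> B)" "f \<in> borel_measurable (count_space UNIV)"
    by simp_all
  have [measurable]: "(\<lambda>p. f (p k)) \<in> borel_measurable (PiM UNIV (\<lambda>_. count_space UNIV))" for k :: nat
    by measurable
  \<comment> \<open>The hitting time takes countably many values, so evaluation at a random index
    reduces to evaluation at fixed ones.\<close>
  have "(\<lambda>p. f (p (LEAST k. p k \<in> B))) \<in> borel_measurable (PiM (UNIV :: nat set) (\<lambda>_. count_space UNIV))"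
    by (rule measurable_compose_countable[where f = "\<lambda>k p. f (p k)"]) measurable
  then show ?thesis unfolding payoff_def by measurable
qed

interpretation coins: sequence_space "measure_pmf (bernoulli_pmf (1/2))" ..

text \<open>Points and lists carry the discrete sigma-algebra, so \<open>S\<close> and
  \<open>reflection\<close> are measurable and only the coins matter.\<close>

lemma history_measurable:
  "(\<lambda>c. history V r \<delta> S x c k) \<in> coins \<rightarrow>\<^sub>M count_space UNIV"
proof (induction k)
  case (Suc k)
  have c: "(\<lambda>c. c k) \<in> coins \<rightarrow>\<^sub>M count_space UNIV"
    unfolding coins_def by measurable
  have "(\<lambda>c. (if c k then history V r \<delta> S x c k @ [S (history V r \<delta> S x c k)]
      else history V r \<delta> S x c k @ [reflection V r \<delta> (last (history V r \<delta> S x c k)) (S (history V r \<delta> S x c k))]))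
    \<in> coins \<rightarrow>\<^sub>M count_space UNIV"
    by (intro measurable_If measurable_compose[OF Suc.IH] c) (use c in \<open>auto simp: pred_def[symmetric]\<close>)
  also have "(\<lambda>c. (if c k then history V r \<delta> S x c k @ [S (history V r \<delta> S x c k)]
      else history V r \<delta> S x c k @ [reflection V r \<delta> (last (history V r \<delta> S x c k)) (S (history V r \<delta> S x c k))]))
     = (\<lambda>c. history V r \<delta> S x c (Suc k))"
    by (auto simp: Let_def)
  finally show ?case .
qed simp

lemma path_measurable:
  "(\<lambda>c k. last (history V r \<delta> S x c k)) \<in> coins \<rightarrow>\<^sub>M PiM UNIV (\<lambda>_. count_space UNIV)"
  by (intro measurable_PiM_single' measurable_compose[OF history_measurable]) auto

section \<open>Expected cost of a fixed strategy\<close>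

definition game_cost ::
    "'d::{finite,linorder} point set \<Rightarrow> real \<Rightarrow> real \<Rightarrow> 'd point set \<Rightarrow> ('d point \<Rightarrow> real) \<Rightarrow>
     ('d point list \<Rightarrow> 'd point) \<Rightarrow> 'd point \<Rightarrow> real" where
  "game_cost V r \<delta> B f S x = (\<integral>p. payoff B f p \<partial>game_law V r \<delta> S x)"

lemma game_cost_eq_coins:
  "game_cost V r \<delta> B f S x = (\<integral>c. payoff B f (\<lambda>k. last (history V r \<delta> S x c k)) \<partial>coins)"
  unfolding game_cost_def game_law_def by (rule integral_distr[OF path_measurable payoff_measurable])

lemma game_cost_uminus: "game_cost V r \<delta> B (\<lambda>x. - f x) S x = - game_cost V r \<delta> B f S x"
  by (simp add: game_cost_def payoff_uminus)

lemma prob_space_coins: "prob_space coins"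
  unfolding coins_def by unfold_locales

lemma game_cost_abs_le:
  assumes "\<And>x. x \<in> B \<Longrightarrow> \<bar>f x\<bar> \<le> F" "0 \<le> F"
  shows "\<bar>game_cost V r \<delta> B f S x\<bar> \<le> F"
proof -
  interpret P: prob_space coins by (rule prob_space_coins)
  have m: "(\<lambda>c. payoff B f (\<lambda>k. last (history V r \<delta> S x c k))) \<in> borel_measurable coins"
    by (rule measurable_compose[OF path_measurable payoff_measurable])
  have "integrable coins (\<lambda>c. payoff B f (\<lambda>k. last (history V r \<delta> S x c k)))"
    using payoff_abs_le[of B f, OF assms] by (intro P.integrable_const_bound[OF _ m, of F]) simp
  then have "-F \<le> game_cost V r \<delta> B f S x" "game_cost V r \<delta> B f S x \<le> F"
    unfolding game_cost_eq_coins using payoff_abs_le[of B f, OF assms]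
    by (auto intro!: P.integral_ge_const P.integral_le_const simp: abs_le_iff minus_le_iff)
  then show ?thesis by simp
qed

lemma game_cost_boundary:
  assumes "x \<in> B"
  shows "game_cost V r \<delta> B f S x = f x"
proof -
  interpret P: prob_space coins by (rule prob_space_coins)
  have "payoff B f (\<lambda>k. last (history V r \<delta> S x c k)) = f x" for c
    using assms by (subst payoff_shift) simp
  then show ?thesis by (simp add: game_cost_eq_coins P.prob_space)
qed

text \<open>\<open>coins\<close> is the law of a fair bit put in front of an independent copy of
  \<open>coins\<close>, so Fubini conditions on that bit; bounded boundary data give
  integrability.\<close>

lemma game_cost_first_step:
  assumes "x \<notin> B" and bd: "\<And>x. x \<in> B \<Longrightarrow> \<bar>f x\<bar> \<le> F" "0 \<le> F"
  shows "game_cost V r \<delta> B f S x =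
    1/2 * game_cost V r \<delta> B f (\<lambda>h. S (x # h)) (S [x]) +
    1/2 * game_cost V r \<delta> B f (\<lambda>h. S (x # h)) (reflection V r \<delta> x (S [x]))"
proof -
  let ?b = "measure_pmf (bernoulli_pmf (1/2))"
  interpret P: prob_space coins by (rule prob_space_coins)
  interpret Q: pair_prob_space ?b coins ..
  define g where "g c = payoff B f (\<lambda>k. last (history V r \<delta> S x c k))" for c
  have g_meas: "g \<in> borel_measurable coins"
    unfolding g_def by (rule measurable_compose[OF path_measurable payoff_measurable])
  have cons: "(\<lambda>(s, \<omega>). case_nat s \<omega>) \<in> ?b \<Otimes>\<^sub>M coins \<rightarrow>\<^sub>M coins"
    unfolding coins_def by measurable
  have law: "distr (?b \<Otimes>\<^sub>M coins) coins (\<lambda>(s, \<omega>). case_nat s \<omega>) = coins"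
    unfolding coins_def by (rule coins.PiM_iter)
  have int: "integrable (?b \<Otimes>\<^sub>M coins) (\<lambda>p. g ((\<lambda>(s, \<omega>). case_nat s \<omega>) p))"
    using payoff_abs_le[of B f, OF bd]
    by (intro Q.integrable_const_bound[of _ F] measurable_compose[OF cons g_meas]) (simp add: g_def)
  have step: "g (case_nat s \<omega>) = payoff B f (\<lambda>k. last (history V r \<delta> (\<lambda>h. S (x # h))
      (if s then S [x] else reflection V r \<delta> x (S [x])) \<omega> k))" for s \<omega>
    unfolding g_def using assms(1) by (subst payoff_shift) (simp add: history_Suc_shift del: history.simps(2))
  have "game_cost V r \<delta> B f S x = (\<integral>c. g c \<partial>coins)"
    by (simp add: game_cost_eq_coins g_def)
  also have "\<dots> = (\<integral>p. g ((\<lambda>(s, \<omega>). case_nat s \<omega>) p) \<partial>(?b \<Otimes>\<^sub>M coins))"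
    by (subst law[symmetric], rule integral_distr[OF cons g_meas])
  also have "\<dots> = (\<integral>s. (\<integral>\<omega>. g (case_nat s \<omega>) \<partial>coins) \<partial>?b)"
    using Q.integral_fst'[OF int] by simp
  also have "\<dots> = 1/2 * game_cost V r \<delta> B f (\<lambda>h. S (x # h)) (S [x]) +
    1/2 * game_cost V r \<delta> B f (\<lambda>h. S (x # h)) (reflection V r \<delta> x (S [x]))"
    by (simp add: step game_cost_eq_coins)
  finally show ?thesis .
qed


section \<open>The maximum principle\<close>

lemma Min_image_mono:
  fixes a b :: "'b \<Rightarrow> real"
  assumes "finite A" "A \<noteq> {}" "\<And>y. y \<in> A \<Longrightarrow> a y \<le> b y"
  shows "Min (a ` A) \<le> Min (b ` A)"
proof (rule Min.boundedI)
  fix z assume "z \<in> b ` A"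
  then obtain y where y: "y \<in> A" "z = b y" by blast
  then have "Min (a ` A) \<le> a y" using assms(1) by simp
  also have "a y \<le> z" using assms(3) y by simp
  finally show "Min (a ` A) \<le> z" .
qed (use assms in auto)

lemma tendsto_Min_image:
  fixes a :: "nat \<Rightarrow> 'b \<Rightarrow> real"
  assumes "finite A" "A \<noteq> {}" "\<And>y. y \<in> A \<Longrightarrow> (\<lambda>k. a k y) \<longlonglongrightarrow> b y"
  shows "(\<lambda>k. Min (a k ` A)) \<longlonglongrightarrow> Min (b ` A)"
  using assms
proof (induction rule: finite_ne_induct)
  case (insert y F)
  then have "(\<lambda>k. min (a k y) (Min (a k ` F))) \<longlonglongrightarrow> min (b y) (Min (b ` F))"
    by (intro tendsto_min) simp_all
  with insert.hyps show ?case by simp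
qed simp

text \<open>The deterministic properties of the graph on which the game argument rests; the sampling
  of the points enters only when they are verified. In \<open>progress\<close> the norm acts as a
  potential that grows along at least one of the two moves.\<close>

locale reflection_game =
  fixes V :: "'d::{finite,linorder} point set" and r \<delta> :: real and D :: "'d point set"
    and f :: "'d point \<Rightarrow> real"
  assumes finite_V: "finite V" and V_nonempty: "V \<noteq> {}" and V_cube: "V \<subseteq> cbox 0 1"
    and far_nonempty: "x \<in> V \<Longrightarrow> far_neighbours V r \<delta> x \<noteq> {}"
    and progress: "\<lbrakk>x \<in> V \<inter> D; y \<in> far_neighbours V r \<delta> x\<rbrakk>
      \<Longrightarrow> norm x < norm y \<or> norm x < norm (reflection V r \<delta> x y)"
begin

abbreviation "C \<equiv> largest_component V r"
abbreviation "B \<equiv> boundary_vertices V r D"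
abbreviation "N \<equiv> far_neighbours V r \<delta>"
abbreviation "R \<equiv> reflection V r \<delta>"

lemma C_subset: "C \<subseteq> V"
  by (rule largest_component_subset[OF finite_V V_nonempty])

lemma finite_C: "finite C"
  using finite_subset[OF C_subset finite_V] .

lemma B_subset: "B \<subseteq> C"
  by (auto simp: boundary_vertices_def)

lemma interior_eq: "interior_vertices V r D = C - B"
  using C_subset V_cube by (auto simp: boundary_vertices_def interior_vertices_def)

lemma finite_N: "finite (N x)"
  using finite_subset[OF far_neighbours_subset finite_V] .

lemma N_nonempty: "x \<in> C \<Longrightarrow> N x \<noteq> {}"
  using far_nonempty[of x] C_subset by auto

lemma N_in_C: "\<lbrakk>x \<in> C; y \<in> N x\<rbrakk> \<Longrightarrow> y \<in> C"
  using far_neighbours_largest_component[OF finite_V V_nonempty, of x r \<delta>] by auto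

lemma R_in_C: "x \<in> C \<Longrightarrow> R x y \<in> C"
  by (rule N_in_C[OF _ reflection_in_far_neighbours[OF finite_V N_nonempty]])

lemma strategies_first: "\<lbrakk>S \<in> strategies V r \<delta>; x \<in> C\<rbrakk> \<Longrightarrow> S [x] \<in> N x"
  unfolding strategies_def by (drule CollectD, drule spec[of _ "[x]"]) simp

lemma boundary_data_bound:
  fixes g :: "'d point \<Rightarrow> real"
  obtains F where "0 \<le> F" "\<And>x. x \<in> B \<Longrightarrow> \<bar>g x\<bar> \<le> F"
proof
  have "finite B" using finite_subset[OF B_subset finite_C] .
  then show "\<bar>g x\<bar> \<le> (\<Sum>z\<in>B. \<bar>g z\<bar>)" if "x \<in> B" for x
    by (rule member_le_sum[OF that, of "\<lambda>z. \<bar>g z\<bar>", rotated]) simp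
  show "0 \<le> (\<Sum>z\<in>B. \<bar>g z\<bar>)" by (rule sum_nonneg) simp
qed

text \<open>
  The largest value of \<open>u - game_cost\<close>, over all states and strategies, would be inherited by
  both successors of a state where it is attained, and one of them is further away from the origin.
\<close>

lemma subsolution_le_game_cost:
  assumes \<S>: "\<S> \<subseteq> strategies V r \<delta>"
    and shift: "\<And>S x. \<lbrakk>S \<in> \<S>; x \<in> C\<rbrakk> \<Longrightarrow> (\<lambda>h. S (x # h)) \<in> \<S>"
    and sub: "\<And>S x. \<lbrakk>S \<in> \<S>; x \<in> C - B\<rbrakk> \<Longrightarrow> u x \<le> 1/2 * u (S [x]) + 1/2 * u (R x (S [x]))"
    and bdry: "\<And>x. x \<in> B \<Longrightarrow> u x \<le> g x"
    and S0: "S0 \<in> \<S>" and x0: "x0 \<in> C"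
  shows "u x0 \<le> game_cost V r \<delta> B g S0 x0"
proof (rule ccontr)
  assume neg: "\<not> u x0 \<le> game_cost V r \<delta> B g S0 x0"
  let ?J = "game_cost V r \<delta> B g"
  \<comment> \<open>After one move the continuation plays a shifted strategy, so the gap is
    maximised over the whole class of strategies as well as over the vertices.\<close>
  define m where "m x = (SUP S\<in>\<S>. u x - ?J S x)" for x
  obtain F where F: "0 \<le> F" "\<And>x. x \<in> B \<Longrightarrow> \<bar>g x\<bar> \<le> F"
    using boundary_data_bound[of g] by blast
  have bdd: "bdd_above ((\<lambda>S. u x - ?J S x) ` \<S>)" for x
  proof (rule bdd_aboveI2)
    show "u x - ?J S x \<le> u x + F" for S
      using game_cost_abs_le[of B g F V r \<delta> S x] F by (simp add: abs_le_iff)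
  qed
  have le_m: "u x - ?J S x \<le> m x" if "S \<in> \<S>" for S x
    unfolding m_def using that bdd by (rule cSUP_upper)
  have m_le: "m x \<le> q" if "\<And>S. S \<in> \<S> \<Longrightarrow> u x - ?J S x \<le> q" for x q
    unfolding m_def using S0 that by (intro cSUP_least) auto
  define M where "M = Max (m ` C)"
  have le_M: "m x \<le> M" if "x \<in> C" for x
    unfolding M_def using that finite_C by simp
  have M_pos: "0 < M"
    using neg le_m[OF S0, of x0] le_M[OF x0] by linarith
  define T where "T = {x \<in> C. m x = M}"
  have finT: "finite T" using finite_C by (simp add: T_def)
  have "M \<in> m ` C" unfolding M_def using finite_C x0 by (intro Max_in) auto
  then have "T \<noteq> {}" by (auto simp: T_def)
  \<comment> \<open>Among the states of maximal gap one farthest from the origin is chosen, so that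
    \<open>progress\<close> leads out of \<open>T\<close>.\<close>
  then have "Max (norm ` T) \<in> norm ` T" using finT by (intro Max_in) auto
  then obtain x where x: "x \<in> T" "norm x = Max (norm ` T)" by force
  have x_max: "norm y \<le> norm x" if "y \<in> T" for y
    using that finT by (simp add: x(2))
  have xC: "x \<in> C" and mx: "m x = M" using x(1) by (auto simp: T_def)
  have xB: "x \<notin> B"
  proof
    assume "x \<in> B"
    then have "m x \<le> 0" using bdry by (intro m_le) (simp add: game_cost_boundary)
    then show False using mx M_pos by simp
  qed
  define a where "a y = 1/2 * m y + 1/2 * m (R x y)" for y
  have a_less: "a y < M" if y: "y \<in> N x" for y
  proof -
    have "norm x < norm y \<or> norm x < norm (R x y)"
      using progress[OF _ y] xC xB C_subset V_cube by (auto simp: boundary_vertices_def)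
    then have "y \<notin> T \<or> R x y \<notin> T" using x_max by force
    then have "m y \<noteq> M \<or> m (R x y) \<noteq> M" using N_in_C[OF xC y] R_in_C[OF xC] by (auto simp: T_def)
    then show ?thesis
      using le_M[OF N_in_C[OF xC y]] le_M[OF R_in_C[OF xC, of y]] by (auto simp: a_def)
  qed
  \<comment> \<open>The supremum over strategies need not be attained and could lose strictness; a
    maximum over the finitely many first moves preserves it.\<close>
  have "m x \<le> Max (a ` N x)"
  proof (rule m_le)
    fix S assume S: "S \<in> \<S>"
    let ?y = "S [x]" and ?S = "\<lambda>h. S (x # h)"
    have y: "?y \<in> N x" using strategies_first[of S x] S \<S> xC by auto
    have "u x - ?J S x \<le> 1/2 * (u ?y - ?J ?S ?y) + 1/2 * (u (R x ?y) - ?J ?S (R x ?y))"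
      using sub[OF S, of x] game_cost_first_step[of x B g F V r \<delta> S, OF xB F(2) F(1)] xC xB
      by (simp add: algebra_simps)
    also have "\<dots> \<le> a ?y"
      unfolding a_def by (intro add_mono mult_left_mono le_m shift[OF S xC]) simp_all
    also have "\<dots> \<le> Max (a ` N x)" using y finite_N by simp
    finally show "u x - ?J S x \<le> Max (a ` N x)" .
  qed
  moreover have "Max (a ` N x) \<in> a ` N x" using finite_N N_nonempty[OF xC] by (intro Max_in) auto
  then obtain y where "y \<in> N x" "Max (a ` N x) = a y" by blast
  ultimately show False using a_less[of y] mx by simp
qed

section \<open>Uniqueness and existence of solutions of the Dynamic Programming Principle\<close>

lemma strategies_shift:
  "\<lbrakk>S \<in> strategies V r \<delta>; x \<in> C\<rbrakk> \<Longrightarrow> (\<lambda>h. S (x # h)) \<in> strategies V r \<delta>"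
  unfolding strategies_def
proof (clarify)
  fix h assume S: "\<forall>h. h \<noteq> [] \<and> set h \<subseteq> C \<longrightarrow> S h \<in> N (last h)" and h: "x \<in> C" "h \<noteq> []" "set h \<subseteq> C"
  show "S (x # h) \<in> N (last h)" using S[rule_format, of "x # h"] h by simp
qed

text \<open>Gives uniqueness and the identification with the value at once: \<open>u\<close> lies
  below every cost, and a strategy choosing minimisers attains it.\<close>

lemma DPP_solution_eq_game_value:
  assumes u: "satisfies_DPP V r \<delta> D f u" and x: "x \<in> C"
  shows "u x = game_value V r \<delta> D f x"
proof -
  let ?a = "\<lambda>x y. 1/2 * u y + 1/2 * u (R x y)"
  have u_int: "u z = Min (?a z ` N z)" if "z \<in> C - B" for z
    using u that by (auto simp: satisfies_DPP_def interior_eq)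
  have u_bd: "u z = f z" if "z \<in> B" for z
    using u that by (auto simp: satisfies_DPP_def)
  have lower: "u x \<le> game_cost V r \<delta> B f S x" if "S \<in> strategies V r \<delta>" for S
  proof (rule subsolution_le_game_cost[OF order_refl strategies_shift _ _ that x])
    fix S z assume "S \<in> strategies V r \<delta>" "z \<in> C - B"
    then show "u z \<le> 1/2 * u (S [z]) + 1/2 * u (R z (S [z]))"
      using u_int[of z] strategies_first[of S z] finite_N[of z] by simp
  qed (use u_bd in auto)
  \<comment> \<open>A class rather than a single strategy, since the comparison lemma asks for
    closure under shifts, and shifting \<open>\<lambda>h. s (last h)\<close> can change its value at
    \<open>[]\<close>.\<close>
  define \<G> where "\<G> = {S \<in> strategies V r \<delta>.
    \<forall>h. h \<noteq> [] \<and> set h \<subseteq> C \<longrightarrow> ?a (last h) (S h) = Min (?a (last h) ` N (last h))}"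
  have \<G>_D: "?a (last h) (S h) = Min (?a (last h) ` N (last h))"
    if "S \<in> \<G>" "h \<noteq> []" "set h \<subseteq> C" for S h
    using that unfolding \<G>_def by blast
  have greedy: "\<exists>y\<in>N z. ?a z y = Min (?a z ` N z)" if "z \<in> C" for z
  proof -
    have "Min (?a z ` N z) \<in> ?a z ` N z" using finite_N N_nonempty[OF that] by (intro Min_in) auto
    then show ?thesis by force
  qed
  define s where "s z = (SOME y. y \<in> N z \<and> ?a z y = Min (?a z ` N z))" for z
  have s: "s z \<in> N z \<and> ?a z (s z) = Min (?a z ` N z)" if "z \<in> C" for z
    unfolding s_def by (rule someI_ex) (use greedy[OF that] in blast)
  have "last h \<in> C" if "h \<noteq> []" "set h \<subseteq> C" for h
    using last_in_set[OF that(1)] that(2) by (rule rev_subsetD)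
  then have S: "(\<lambda>h. s (last h)) \<in> \<G>"
    using s by (simp add: \<G>_def strategies_def)
  \<comment> \<open>Greedy play attains the minimum, so \<open>- u\<close> is a subsolution for the
    data \<open>- f\<close> and the maximum principle applies once more.\<close>
  have "- u x \<le> game_cost V r \<delta> B (\<lambda>x. - f x) (\<lambda>h. s (last h)) x"
  proof (rule subsolution_le_game_cost[OF _ _ _ _ S x])
    show "(\<lambda>h. S (z # h)) \<in> \<G>" if "S \<in> \<G>" "z \<in> C" for S z
    proof -
      have "?a (last h) (S (z # h)) = Min (?a (last h) ` N (last h))" if "h \<noteq> []" "set h \<subseteq> C" for h
        using \<G>_D[OF \<open>S \<in> \<G>\<close>, of "z # h"] that \<open>z \<in> C\<close> by simp
      then show ?thesis using that strategies_shift[of S z] by (simp add: \<G>_def)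
    qed
    show "- u z \<le> 1/2 * - u (S [z]) + 1/2 * - u (R z (S [z]))" if "S \<in> \<G>" "z \<in> C - B" for S z
      using \<G>_D[OF that(1), of "[z]"] u_int[OF that(2)] that(2) by simp
  qed (use u_bd in \<open>auto simp: \<G>_def\<close>)
  then have "game_cost V r \<delta> B f (\<lambda>h. s (last h)) x \<le> u x"
    by (simp add: game_cost_uminus)
  moreover have "(\<lambda>h. s (last h)) \<in> strategies V r \<delta>" using S by (simp add: \<G>_def)
  moreover have "bdd_below ((\<lambda>S. game_cost V r \<delta> B f S x) ` strategies V r \<delta>)"
    using lower by (intro bdd_belowI2)
  ultimately have "(INF S\<in>strategies V r \<delta>. game_cost V r \<delta> B f S x) \<le> u x"
    by (intro cINF_lower2)
  moreover have "u x \<le> (INF S\<in>strategies V r \<delta>. game_cost V r \<delta> B f S x)"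
    using lower S by (intro cINF_greatest) (auto simp: \<G>_def)
  ultimately show ?thesis
    unfolding game_value_def game_cost_def by simp
qed

text \<open>Value iteration from below: the iterates increase and stay below \<open>F\<close>, and a
  minimum over finitely many neighbours passes to the limit.\<close>

lemma DPP_solution_exists: "\<exists>u. satisfies_DPP V r \<delta> D f u"
proof -
  obtain F where F: "0 \<le> F" "\<And>x. x \<in> B \<Longrightarrow> \<bar>f x\<bar> \<le> F"
    using boundary_data_bound[of f] by blast
  let ?T = "\<lambda>w x. if x \<in> B then f x else Min ((\<lambda>y. 1/2 * w y + 1/2 * w (R x y)) ` N x)"
  \<comment> \<open>Starting off \<open>B\<close> at the lower bound \<open>- F\<close> makes the
    first iterate at least as large; monotonicity of the operator propagates this.\<close>
  define w where "w k = (?T ^^ k) (\<lambda>x. if x \<in> B then f x else - F)" for k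
  have w0: "w 0 = (\<lambda>x. if x \<in> B then f x else - F)" by (simp add: w_def)
  have wS: "w (Suc k) = ?T (w k)" for k by (simp only: w_def funpow.simps o_apply)
  have bound: "- F \<le> w k x \<and> w k x \<le> F" if "x \<in> C" for x k
    using that
  proof (induction k arbitrary: x)
    case 0
    then show ?case using F by (auto simp: w0 abs_le_iff minus_le_iff)
  next
    case (Suc k)
    let ?A = "(\<lambda>y. 1/2 * w k y + 1/2 * w k (R x y)) ` N x"
    have "- F \<le> a \<and> a \<le> F" if "a \<in> ?A" for a
    proof -
      obtain y where y: "y \<in> N x" "a = 1/2 * w k y + 1/2 * w k (R x y)" using \<open>a \<in> ?A\<close> by blast
      show ?thesis using Suc.IH[OF N_in_C[OF Suc.prems y(1)]] Suc.IH[OF R_in_C[OF Suc.prems, of y]] y(2) by simp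
    qed
    moreover have "Min ?A \<in> ?A" using finite_N N_nonempty[OF Suc.prems] by (intro Min_in) auto
    ultimately have M: "- F \<le> Min ?A \<and> Min ?A \<le> F" by blast
    show ?case
    proof (cases "x \<in> B")
      case True
      then show ?thesis using F(2)[of x] by (simp add: wS abs_le_iff minus_le_iff)
    next
      case False
      then show ?thesis unfolding wS using M by (simp only: if_False)
    qed
  qed
  have mono: "w k x \<le> w (Suc k) x" if "x \<in> C" for x k
    using that
  proof (induction k arbitrary: x)
    case 0
    show ?case
    proof (cases "x \<in> B")
      case False
      then have "w 0 x = - F" by (simp add: w0)
      then show ?thesis using bound[OF 0, of "Suc 0"] by linarith
    qed (simp add: w0 wS)
  next
    case (Suc k)
    have "1/2 * w k y + 1/2 * w k (R x y) \<le> 1/2 * w (Suc k) y + 1/2 * w (Suc k) (R x y)" if "y \<in> N x" for y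
      using Suc.IH[OF N_in_C[OF Suc.prems that]] Suc.IH[OF R_in_C[OF Suc.prems, of y]] by linarith
    then have "Min ((\<lambda>y. 1/2 * w k y + 1/2 * w k (R x y)) ` N x)
        \<le> Min ((\<lambda>y. 1/2 * w (Suc k) y + 1/2 * w (Suc k) (R x y)) ` N x)"
      using finite_N N_nonempty[OF Suc.prems] by (intro Min_image_mono)
    then show ?case unfolding wS[of "Suc k"] by (subst wS) simp
  qed
  define u where "u x = lim (\<lambda>k. w k x)" for x
  have lim: "(\<lambda>k. w k x) \<longlonglongrightarrow> u x" if "x \<in> C" for x
  proof -
    have "incseq (\<lambda>k. w k x)" using mono[OF that] by (rule incseq_SucI)
    moreover have "\<forall>k. w k x \<le> F" using bound[OF that] by simp
    ultimately obtain L where "(\<lambda>k. w k x) \<longlonglongrightarrow> L" by (rule incseq_convergent)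
    then show ?thesis unfolding u_def by (simp add: limI)
  qed
  have "u x = Min ((\<lambda>y. 1/2 * u y + 1/2 * u (R x y)) ` N x)" if x: "x \<in> C" "x \<notin> B" for x
  proof (rule LIMSEQ_unique)
    show "(\<lambda>k. w (Suc k) x) \<longlonglongrightarrow> u x" using lim[OF x(1)] by (rule LIMSEQ_Suc)
    have "(\<lambda>k. Min ((\<lambda>y. 1/2 * w k y + 1/2 * w k (R x y)) ` N x))
        \<longlonglongrightarrow> Min ((\<lambda>y. 1/2 * u y + 1/2 * u (R x y)) ` N x)"
      using lim N_in_C[OF x(1)] R_in_C[OF x(1)]
      by (intro tendsto_Min_image finite_N N_nonempty x(1) tendsto_add tendsto_mult_left) auto
    then show "(\<lambda>k. w (Suc k) x) \<longlonglongrightarrow> Min ((\<lambda>y. 1/2 * u y + 1/2 * u (R x y)) ` N x)"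
      using x(2) by (simp add: wS)
  qed
  moreover have "u x = f x" if "x \<in> B" for x
  proof -
    have "w k x = f x" for k using that by (cases k) (simp_all add: w0 wS)
    then show ?thesis by (simp add: u_def)
  qed
  ultimately have "satisfies_DPP V r \<delta> D f u"
    using N_nonempty by (auto simp: satisfies_DPP_def interior_eq)
  then show ?thesis by (rule exI[of _ u])
qed

text \<open>Moves and reflections never leave \<open>C\<close>. This transfers the principle to
  \<open>game_value\<close>, which is known to agree with a solution only there.\<close>

lemma satisfies_DPP_cong:
  assumes "satisfies_DPP V r \<delta> D f u" "\<And>x. x \<in> C \<Longrightarrow> u x = v x"
  shows "satisfies_DPP V r \<delta> D f v"
proof -
  have eq: "1/2 * u y + 1/2 * u (R x y) = 1/2 * v y + 1/2 * v (R x y)" if "x \<in> C" "y \<in> N x" for x y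
    by (simp only: assms(2)[OF N_in_C[OF that]] assms(2)[OF R_in_C[OF that(1)]])
  show ?thesis
    unfolding satisfies_DPP_def interior_eq
  proof (intro conjI ballI)
    fix x assume x: "x \<in> C - B"
    then have xC: "x \<in> C" by simp
    show "N x \<noteq> {}" by (rule N_nonempty[OF xC])
    have "v x = u x" using assms(2)[OF xC] by simp
    also have "\<dots> = Min ((\<lambda>y. 1/2 * u y + 1/2 * u (R x y)) ` N x)"
      using assms(1) x unfolding satisfies_DPP_def interior_eq by blast
    also have "(\<lambda>y. 1/2 * u y + 1/2 * u (R x y)) ` N x = (\<lambda>y. 1/2 * v y + 1/2 * v (R x y)) ` N x"
      by (rule image_cong[OF refl eq[OF xC]])
    finally show "v x = Min ((\<lambda>y. 1/2 * v y + 1/2 * v (R x y)) ` N x)" .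
  next
    fix x assume x: "x \<in> B"
    then have "u x = f x" using assms(1) unfolding satisfies_DPP_def by blast
    then show "v x = f x" using assms(2)[of x] x B_subset by auto
  qed
qed

theorem game_value_satisfies_DPP: "satisfies_DPP V r \<delta> D f (game_value V r \<delta> D f)"
proof -
  obtain u where u: "satisfies_DPP V r \<delta> D f u" using DPP_solution_exists ..
  show ?thesis
    by (rule satisfies_DPP_cong[OF u DPP_solution_eq_game_value[OF u]])
qed

end


section \<open>Dense vertex sets\<close>

text \<open>\<open>p\<close> lies in the middle of the annulus of width \<delta> r that defines the
  far neighbours of \<open>x\<close>, so a vertex within \<delta> r / 2 of \<open>p\<close> lies in
  that annulus.\<close>

lemma far_neighbour_near_point:
  fixes V :: "'d::{finite,linorder} point set"
  assumes dense: "\<And>p. p \<in> cbox 0 1 \<Longrightarrow> \<exists>z\<in>V. norm (z - p) < \<delta> * r / 2"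
    and "0 < r" "\<delta> \<le> 1/2" "x \<in> V" "norm v = 1"
    and p: "p = x + ((1 - \<delta>/2) * r) *\<^sub>R v" "p \<in> cbox 0 1"
  obtains z where "z \<in> far_neighbours V r \<delta> x" "norm (z - p) < \<delta> * r / 2"
proof -
  obtain z where z: "z \<in> V" "norm (z - p) < \<delta> * r / 2" using dense[OF p(2)] by blast
  have "norm (p - x) = (1 - \<delta>/2) * r"
    using assms(2,3,5) by (simp add: p(1))
  moreover have "norm (p - x) \<le> norm (z - p) + norm (z - x)"
    using norm_triangle_sub[of "p - x" "z - x"] by (simp add: norm_minus_commute add.commute)
  moreover have "norm (z - x) \<le> norm (z - p) + norm (p - x)"
    using norm_triangle_ineq[of "z - p" "p - x"] by simp
  ultimately have n: "(1 - \<delta>) * r < norm (z - x)" "norm (z - x) < r"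
    using z(2) by (simp_all add: algebra_simps)
  have "0 < (1 - \<delta>) * r" using assms(2,3) by simp
  with n(1) have "z \<noteq> x" by auto
  with n z(1) assms(4) have "z \<in> far_neighbours V r \<delta> x"
    by (simp add: far_neighbours_def neighbours_def adj_rel_def norm_minus_commute)
  then show ?thesis using that z(2) by blast
qed

lemma dense_far_neighbours_nonempty:
  fixes V :: "'d::{finite,linorder} point set"
  assumes dense: "\<And>p. p \<in> cbox 0 1 \<Longrightarrow> \<exists>z\<in>V. norm (z - p) < \<delta> * r / 2"
    and V: "V \<subseteq> cbox 0 1" and r: "0 < r" "r \<le> 1/2" and \<delta>: "0 < \<delta>" "\<delta> \<le> 1/2" and x: "x \<in> V"
  shows "far_neighbours V r \<delta> x \<noteq> {}"
proof -
  obtain i :: 'd where True by simp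
  \<comment> \<open>The direction points away from the nearer face, so a step of length at most 1/2
    stays in the cube.\<close>
  define e :: real where "e = (if x $ i \<le> 1/2 then 1 else -1)"
  define v :: "'d point" where "v = e *\<^sub>R axis i 1"
  have "norm v = 1" by (simp add: v_def e_def)
  let ?t = "(1 - \<delta>/2) * r"
  have t: "0 \<le> ?t" "?t \<le> 1/2"
    using r \<delta> mult_mono[of "1 - \<delta>/2" 1 r "1/2"] by simp_all
  have xb: "0 \<le> x $ j \<and> x $ j \<le> 1" for j
    using x V by (auto simp: mem_box_cart subset_iff)
  have "0 \<le> (x + ?t *\<^sub>R v) $ j \<and> (x + ?t *\<^sub>R v) $ j \<le> 1" for j
  proof (cases "j = i")
    case True
    then have "(x + ?t *\<^sub>R v) $ j = x $ i + ?t * e" by (simp add: v_def axis_def)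
    then show ?thesis using t xb[of i] by (auto simp: e_def)
  next
    case False
    then have "v $ j = 0" by (simp add: v_def axis_def)
    then show ?thesis using xb[of j] by simp
  qed
  then have "x + ?t *\<^sub>R v \<in> cbox 0 1" by (simp add: mem_box_cart)
  from far_neighbour_near_point[OF dense r(1) \<delta>(2) x \<open>norm v = 1\<close> refl this]
  show ?thesis by blast
qed

text \<open>
  The approximate reflection \<open>w\<close> satisfies \<open>y + w = 2 x + O(\<delta> r)\<close>, so \<open>(|y|\<^sup>2 + |w|\<^sup>2) / 2\<close> exceeds
  \<open>|x|\<^sup>2\<close> by about \<open>r\<^sup>2\<close>, up to an error of order \<open>\<delta> r\<close>.
\<close>

lemma reflection_progress:
  fixes V :: "'d::{finite,linorder} point set"
  assumes dense: "\<And>p. p \<in> cbox 0 1 \<Longrightarrow> \<exists>z\<in>V. norm (z - p) < \<delta> * r / 2"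
    and V: "finite V" and r: "0 < r" and \<delta>: "0 < \<delta>" "\<delta> \<le> 1/2"
    and x: "x \<in> V" "cball x r \<subseteq> cbox 0 1" and K: "norm x \<le> K" "4 * K * \<delta> \<le> r"
    and y: "y \<in> far_neighbours V r \<delta> x"
  shows "norm x < norm y \<or> norm x < norm (reflection V r \<delta> x y)"
proof (rule ccontr)
  define w where "w = reflection V r \<delta> x y"
  assume "\<not> ?thesis"
  then have le: "norm y \<le> norm x" "norm w \<le> norm x" by (auto simp: w_def)
  have far: "(1 - \<delta>) * r < norm (z - x) \<and> norm (z - x) < r" if "z \<in> far_neighbours V r \<delta> x" for z
    using that by (simp add: far_neighbours_def neighbours_def adj_rel_def norm_minus_commute)
  have w: "w \<in> far_neighbours V r \<delta> x"
    unfolding w_def by (rule reflection_in_far_neighbours[OF V]) (use y in blast)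
  define s where "s = \<delta> * r"
  have s: "0 < s" "s \<le> r / 2" using r \<delta> mult_right_mono[of \<delta> "1/2" r] by (simp_all add: s_def)
  have t: "(1 - \<delta>/2) * r = r - s / 2" "(1 - \<delta>) * r = r - s" by (simp_all add: s_def algebra_simps)
  have pos: "r/2 \<le> (1 - \<delta>) * r" using t s by linarith
  define l where "l = norm (y - x)"
  have l: "0 < l" "(1 - \<delta>) * r < l" "l < r" using far[OF y] pos r unfolding l_def by linarith+
  define v where "v = (1 / l) *\<^sub>R (x - y)"
  have v: "norm v = 1" using l(1) by (simp add: v_def l_def norm_minus_commute)
  \<comment> \<open>The point opposite to \<open>y\<close> at mid-annulus radius, an approximation
    of the exact reflection \<open>2 *\<^sub>R x - y\<close>.\<close>
  define p where "p = x + ((1 - \<delta>/2) * r) *\<^sub>R v"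
  have "norm (x - p) = \<bar>(1 - \<delta>/2) * r\<bar>" unfolding p_def using v by simp
  also have "\<dots> \<le> r" using r s t by linarith
  finally have "p \<in> cbox 0 1" using x(2) by (auto simp: dist_norm)
  then obtain z where z: "z \<in> far_neighbours V r \<delta> x" "norm (z - p) < \<delta> * r / 2"
    using far_neighbour_near_point[OF dense r \<delta>(2) x(1) v p_def] by blast
  have "p + y - 2 *\<^sub>R x = ((1 - \<delta>/2) * r - l) *\<^sub>R v"
  proof -
    have "l *\<^sub>R v = x - y" using l(1) by (simp add: v_def)
    then have "y = x - l *\<^sub>R v" by (simp add: algebra_simps)
    then show ?thesis by (simp add: p_def scaleR_2 algebra_simps)
  qed
  then have "norm (p + y - 2 *\<^sub>R x) = \<bar>(1 - \<delta>/2) * r - l\<bar>" using v by simp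
  \<comment> \<open>Both radii lie between r - s and r, and the first is the midpoint.\<close>
  also have "\<dots> \<le> s / 2" using l t by linarith
  finally have "norm (p + y - 2 *\<^sub>R x) \<le> s / 2" .
  moreover have "norm (z + y - 2 *\<^sub>R x) \<le> norm (z - p) + norm (p + y - 2 *\<^sub>R x)"
    using norm_triangle_ineq[of "z - p" "p + y - 2 *\<^sub>R x"] by (simp add: algebra_simps)
  ultimately have "norm (z + y - 2 *\<^sub>R x) \<le> s" using z(2) unfolding s_def by linarith
  then have err: "norm (w + y - 2 *\<^sub>R x) \<le> s"
    using reflection_minimal[OF V z(1), of y] unfolding w_def by linarith
  \<comment> \<open>By expansion, 2 x . (q - x) = |q|^2 - |x|^2 - |q - x|^2.\<close>
  have inner: "2 * (x \<bullet> (q - x)) \<le> - (norm (q - x))\<^sup>2" if "norm q \<le> norm x" for q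
  proof -
    have "(norm q)\<^sup>2 \<le> (norm x)\<^sup>2" using that by (simp add: power_mono)
    then show ?thesis unfolding power2_norm_eq_inner by (simp add: algebra_simps inner_commute)
  qed
  have sq: "r\<^sup>2 / 4 < (norm (q - x))\<^sup>2" if "q \<in> far_neighbours V r \<delta> x" for q
  proof -
    have "r/2 < norm (q - x)" using far[OF that] pos by linarith
    then have "(r/2)\<^sup>2 < (norm (q - x))\<^sup>2" using r by (intro power_strict_mono) auto
    then show ?thesis by (simp add: power_divide)
  qed
  have "2 * (x \<bullet> (w + y - 2 *\<^sub>R x)) = 2 * (x \<bullet> (y - x)) + 2 * (x \<bullet> (w - x))"
    by (simp add: inner_diff_right inner_add_right)
  also have "\<dots> < - r\<^sup>2 / 2"
    using inner[OF le(1)] inner[OF le(2)] sq[OF y] sq[OF w] by simp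
  finally have upper: "x \<bullet> (w + y - 2 *\<^sub>R x) < - r\<^sup>2 / 4" by simp
  \<comment> \<open>With \<open>s = \<delta> * r\<close>, the assumption on \<open>K\<close> keeps
    the error within r^2 / 4, contradicting \<open>upper\<close>.\<close>
  have "\<bar>x \<bullet> (w + y - 2 *\<^sub>R x)\<bar> \<le> norm x * norm (w + y - 2 *\<^sub>R x)"
    by (rule Cauchy_Schwarz_ineq2)
  also have "\<dots> \<le> K * s"
    using K(1) err by (intro mult_mono) (auto intro: order_trans[OF norm_ge_zero])
  also have "\<dots> \<le> r\<^sup>2 / 4"
    using mult_right_mono[OF K(2), of r] r by (simp add: s_def power2_eq_square algebra_simps)
  finally show False using upper by linarith
qed

lemma dense_reflection_game:
  fixes V :: "'d::{finite,linorder} point set"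
  assumes dense: "\<And>p. p \<in> cbox 0 1 \<Longrightarrow> \<exists>z\<in>V. norm (z - p) < \<delta> * r / 2"
    and V: "finite V" "V \<subseteq> cbox 0 1" and r: "0 < r" "r \<le> 1/2" and \<delta>: "0 < \<delta>" "\<delta> \<le> 1/2"
    and D: "\<And>x. x \<in> D \<Longrightarrow> cball x r \<subseteq> cbox 0 1"
    and K: "\<And>x. x \<in> V \<Longrightarrow> norm x \<le> K" "4 * K * \<delta> \<le> r"
  shows "reflection_game V r \<delta> D"
proof
  have "(0 :: 'd point) \<in> cbox 0 1" by (simp add: mem_box_cart)
  then show "V \<noteq> {}" using dense by blast
  show "far_neighbours V r \<delta> x \<noteq> {}" if "x \<in> V" for x
    by (rule dense_far_neighbours_nonempty[OF dense V(2) r \<delta> that])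
  show "norm x < norm y \<or> norm x < norm (reflection V r \<delta> x y)"
    if "x \<in> V \<inter> D" "y \<in> far_neighbours V r \<delta> x" for x y
    using reflection_progress[OF dense V(1) r(1) \<delta> _ D K(1) K(2) that(2)] that(1) by blast
qed (use V in auto)


section \<open>Uniform points hit every cell of a fine grid\<close>

text \<open>Closed cells share faces; covering the cube and the union bound both tolerate such
  overlaps.\<close>

definition grid_cell :: "nat \<Rightarrow> ('d::finite \<Rightarrow> nat) \<Rightarrow> 'd point set" where
  "grid_cell m j = cbox (\<chi> i. real (j i) / real m) (\<chi> i. (real (j i) + 1) / real m)"

abbreviation grid :: "nat \<Rightarrow> ('d::finite \<Rightarrow> nat) set" where
  "grid m \<equiv> PiE UNIV (\<lambda>_. {..<m})"

lemma mem_grid_cell: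
  "x \<in> grid_cell m j \<longleftrightarrow> (\<forall>i. real (j i) / real m \<le> x $ i \<and> x $ i \<le> (real (j i) + 1) / real m)"
  by (auto simp: grid_cell_def mem_box_cart)

lemma grid_cell_cover:
  fixes p :: "'d::finite point"
  assumes "p \<in> cbox 0 1" "0 < m"
  obtains j where "j \<in> grid m" "p \<in> grid_cell m j"
proof
  \<comment> \<open>The cap \<open>m - 1\<close> serves coordinates equal to 1, whose floor would be
    \<open>m\<close>, beyond the last cell.\<close>
  define j where "j i = min (m - 1) (nat \<lfloor>real m * p $ i\<rfloor>)" for i
  have p: "0 \<le> p $ i" "p $ i \<le> 1" for i
    using assms(1) by (auto simp: mem_box_cart)
  show "j \<in> grid m" using assms(2) by (auto simp: j_def)
  have "real (j i) \<le> real m * p $ i \<and> real m * p $ i \<le> real (j i) + 1" for i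
  proof -
    have f: "real (nat \<lfloor>real m * p $ i\<rfloor>) = of_int \<lfloor>real m * p $ i\<rfloor>"
      using p by simp
    have fl: "of_int \<lfloor>real m * p $ i\<rfloor> \<le> real m * p $ i" "real m * p $ i < of_int \<lfloor>real m * p $ i\<rfloor> + 1"
      by linarith+
    have le: "real m * p $ i \<le> real m" using p[of i] mult_left_mono[of "p $ i" 1 "real m"] by simp
    have j: "real (j i) = min (real m - 1) (of_int \<lfloor>real m * p $ i\<rfloor>)"
      using assms(2) by (simp add: j_def of_nat_min f)
    show ?thesis unfolding j using fl le by linarith
  qed
  then show "p \<in> grid_cell m j"
    using assms(2) by (simp add: mem_grid_cell field_simps)
qed

text \<open>The l1 norm dominates the Euclidean norm, and each of the d coordinates differs by at
  most 1/m.\<close>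

lemma grid_cell_diameter:
  fixes p q :: "'d::finite point"
  assumes "p \<in> grid_cell m j" "q \<in> grid_cell m j"
  shows "norm (p - q) \<le> real CARD('d) / real m"
proof -
  have "\<bar>(p - q) $ i\<bar> \<le> 1 / real m" for i
  proof -
    have "real (j i) / real m \<le> p $ i" "p $ i \<le> real (j i) / real m + 1 / real m"
      "real (j i) / real m \<le> q $ i" "q $ i \<le> real (j i) / real m + 1 / real m"
      using assms by (auto simp: mem_grid_cell add_divide_distrib)
    then show ?thesis by (simp add: abs_le_iff)
  qed
  then have "(\<Sum>i\<in>UNIV. \<bar>(p - q) $ i\<bar>) \<le> (\<Sum>i\<in>(UNIV :: 'd set). 1 / real m)"
    by (intro sum_mono)
  then show ?thesis using norm_le_l1_cart[of "p - q"] by simp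
qed

lemma grid_cell_subset:
  assumes "j \<in> grid m"
  shows "grid_cell m j \<subseteq> (cbox 0 1 :: 'd::finite point set)"
proof
  fix x :: "'d point" assume x: "x \<in> grid_cell m j"
  have "0 \<le> x $ i \<and> x $ i \<le> 1" for i
  proof -
    have "j i < m" using assms by auto
    then have "0 \<le> real (j i) / real m" "(real (j i) + 1) / real m \<le> 1" by simp_all
    moreover have "real (j i) / real m \<le> x $ i" "x $ i \<le> (real (j i) + 1) / real m"
      using x by (simp_all add: mem_grid_cell)
    ultimately show ?thesis by linarith
  qed
  then show "x \<in> cbox 0 1" by (simp add: mem_box_cart)
qed

lemma measure_grid_cell:
  assumes "0 < m"
  shows "measure lborel (grid_cell m j :: 'd::finite point set) = (1 / real m) ^ CARD('d)"
proof -
  have "(\<chi> i. real (j i) / real m) \<in> (grid_cell m j :: 'd point set)"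
    using assms by (simp add: mem_grid_cell divide_right_mono)
  then have "cbox (\<chi> i. real (j i) / real m) (\<chi> i. (real (j i) + 1) / real m) \<noteq> ({} :: 'd point set)"
    unfolding grid_cell_def by blast
  then show ?thesis
    unfolding grid_cell_def by (simp add: content_cbox_cart diff_divide_distrib[symmetric])
qed

section \<open>Uniform law on the cube and the probability of an empty cell\<close>

definition cube_measure :: "'d::finite point measure" where
  "cube_measure = restrict_space lborel (cbox 0 1)"

lemma prob_space_cube: "prob_space (cube_measure :: 'd::finite point measure)"
proof
  have "emeasure lborel (cbox 0 1 :: 'd point set) = ennreal (measure lborel (cbox 0 1 :: 'd point set))"
    by (intro emeasure_eq_ennreal_measure) (metis emeasure_lborel_cbox_finite infinity_ennreal_def less_irrefl)
  moreover have "measure lborel (cbox 0 1 :: 'd point set) = 1"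
    by (subst content_cbox_cart) (auto simp: interval_ne_empty_cart)
  ultimately show "emeasure cube_measure (space (cube_measure :: 'd point measure)) = 1"
    by (simp add: cube_measure_def space_restrict_space emeasure_restrict_space)
qed

lemma sample_space_eq: "sample_space = PiM UNIV (\<lambda>_. cube_measure)"
  by (simp add: sample_space_def cube_measure_def)

lemma prob_space_sample: "prob_space (sample_space :: (nat \<Rightarrow> 'd::finite point) measure)"
  unfolding sample_space_eq by (rule prob_space_PiM[OF prob_space_cube])

lemma sample_space_points: "X \<in> space sample_space \<Longrightarrow> points X n \<subseteq> cbox 0 1"
  by (auto simp: sample_space_eq space_PiM cube_measure_def space_restrict_space points_def)

text \<open>Written as membership in the complement within the cube, so that the event is a
  finite-dimensional cylinder.\<close>

definition missed :: "nat \<Rightarrow> nat \<Rightarrow> ('d::finite \<Rightarrow> nat) \<Rightarrow> (nat \<Rightarrow> 'd point) set" where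
  "missed n m j = {X \<in> space sample_space. \<forall>k\<in>{1..n}. X k \<in> cbox 0 1 - grid_cell m j}"

text \<open>By independence the probabilities multiply: each point avoids the cell with probability
  1 - m^(-d).\<close>

lemma
  fixes j :: "'d::finite \<Rightarrow> nat"
  assumes "0 < m" "j \<in> grid m"
  shows missed_sets: "missed n m j \<in> sets sample_space"
    and measure_missed: "measure sample_space (missed n m j) = (1 - (1 / real m) ^ CARD('d)) ^ n"
proof -
  let ?A = "cbox 0 1 - grid_cell m j :: 'd point set"
  have cell: "grid_cell m j \<subseteq> cbox 0 1" by (rule grid_cell_subset[OF assms(2)])
  have sets_cell: "grid_cell m j \<in> sets (cube_measure :: 'd point measure)"
    using cell by (simp add: cube_measure_def sets_restrict_space_iff) (simp add: grid_cell_def)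
  have sp: "space (cube_measure :: 'd point measure) = cbox 0 1"
    by (simp add: cube_measure_def space_restrict_space)
  have A: "?A \<in> sets cube_measure"
    using sets.compl_sets[OF sets_cell] sp by simp
  have "{X \<in> space (PiM UNIV (\<lambda>_. cube_measure)). X k \<in> ?A} \<in> sets (PiM UNIV (\<lambda>_. cube_measure))" for k :: nat
    using A by measurable
  then show "missed n m j \<in> sets sample_space"
    unfolding missed_def sample_space_eq by (intro sets.sets_Collect_finite_All) auto
  interpret U: prob_space "cube_measure :: 'd point measure" by (rule prob_space_cube)
  interpret cube: product_prob_space "\<lambda>_ :: nat. cube_measure :: 'd point measure" UNIV ..
  have "measure cube_measure (grid_cell m j) = (1 / real m) ^ CARD('d)"
    unfolding cube_measure_def using cell by (subst measure_restrict_space) (simp_all add: measure_grid_cell assms(1))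
  then have "measure cube_measure ?A = 1 - (1 / real m) ^ CARD('d)"
    using U.prob_compl[OF sets_cell] sp by simp
  moreover have "emeasure sample_space (missed n m j) = (\<Prod>k\<in>{1..n}. emeasure cube_measure ?A)"
    unfolding missed_def sample_space_eq by (rule cube.emeasure_PiM_Collect) (use A in auto)
  moreover have q: "0 \<le> 1 - (1 / real m) ^ CARD('d)" using assms(1) by (simp add: power_le_one)
  ultimately have "emeasure sample_space (missed n m j) = ennreal ((1 - (1 / real m) ^ CARD('d)) ^ n)"
    by (simp add: U.emeasure_eq_measure ennreal_power)
  then show "measure sample_space (missed n m j) = (1 - (1 / real m) ^ CARD('d)) ^ n"
    using q by (intro measure_eq_emeasure_eq_ennreal) simp_all
qed

text \<open>Union bound over the m^d cells, with 1 - q \<le> exp (- q).\<close>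

lemma missed_union_measure_le:
  assumes "0 < m"
  shows "measure sample_space (\<Union>j\<in>grid m. missed n m (j :: 'd::finite \<Rightarrow> nat))
    \<le> real m ^ CARD('d) * exp (- real n / real m ^ CARD('d))"
proof -
  interpret P: prob_space "sample_space :: (nat \<Rightarrow> 'd point) measure"
    by (rule prob_space_sample)
  have fin: "finite (grid m :: ('d \<Rightarrow> nat) set)" by (intro finite_PiE) auto
  let ?q = "(1 / real m) ^ CARD('d)"
  have q: "0 \<le> ?q" "?q \<le> 1" using assms by (auto intro: power_le_one)
  have "measure sample_space (\<Union>j\<in>grid m. missed n m (j :: 'd \<Rightarrow> nat))
      \<le> (\<Sum>j\<in>(grid m :: ('d \<Rightarrow> nat) set). measure sample_space (missed n m j))"
    using missed_sets[OF assms] by (intro measure_UNION_le fin) auto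
  also have "\<dots> = (\<Sum>j\<in>(grid m :: ('d \<Rightarrow> nat) set). (1 - ?q) ^ n)"
    by (intro sum.cong refl measure_missed assms)
  also have "\<dots> = real m ^ CARD('d) * (1 - ?q) ^ n"
    by (simp add: card_PiE)
  also have "\<dots> \<le> real m ^ CARD('d) * exp (- ?q) ^ n"
    using q exp_ge_add_one_self[of "- ?q"] by (intro mult_left_mono power_mono) auto
  also have "exp (- ?q) ^ n = exp (- real n / real m ^ CARD('d))"
    by (simp add: exp_of_nat_mult[symmetric] power_one_over)
  finally show ?thesis .
qed

lemma not_missed_dense:
  fixes p :: "'d::finite point"
  assumes "X \<in> space sample_space - (\<Union>j\<in>grid m. missed n m j)" "0 < m" "p \<in> cbox 0 1"
  shows "\<exists>z\<in>points X n. norm (z - p) \<le> real CARD('d) / real m"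
proof -
  obtain j where j: "j \<in> grid m" "p \<in> grid_cell m j" using grid_cell_cover[OF assms(3,2)] by blast
  have X: "X k \<in> cbox 0 1" for k
    using assms(1) by (auto simp: sample_space_eq space_PiM cube_measure_def space_restrict_space)
  have "X \<notin> missed n m j" using assms(1) j(1) by blast
  then obtain k where k: "k \<in> {1..n}" "X k \<in> grid_cell m j"
    using assms(1) X by (auto simp: missed_def)
  from k(1) have "X k \<in> points X n" by (auto simp: points_def)
  moreover have "norm (X k - p) \<le> real CARD('d) / real m" by (rule grid_cell_diameter[OF k(2) j(2)])
  ultimately show ?thesis by blast
qed

text \<open>
  The mesh \<open>1 / m \<approx> n powr (-3 / (4 d))\<close> is coarse enough for every cell to contain about
  \<open>n powr (1/4)\<close> points, and fine compared to \<open>\<delta>\<^sub>n r\<^sub>n\<close> by the hypothesis on \<open>r\<^sub>n\<close>.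
\<close>

definition mesh :: "nat \<Rightarrow> nat \<Rightarrow> nat" where
  "mesh d n = nat \<lfloor>real n powr (3 / (4 * real d))\<rfloor>"

lemma mesh_pos: "0 < n \<Longrightarrow> 0 < mesh d n"
  by (simp add: mesh_def ge_one_powr_ge_zero)

lemma mesh_power_le:
  assumes "0 < d" "0 < n"
  shows "real (mesh d n) ^ d \<le> real n powr (3/4)"
proof -
  have "real (mesh d n) \<le> real n powr (3 / (4 * real d))" by (simp add: mesh_def)
  then have "real (mesh d n) ^ d \<le> (real n powr (3 / (4 * real d))) ^ d" by (intro power_mono) auto
  also have "\<dots> = real n powr (3/4)" using assms by (simp add: powr_powr flip: powr_realpow)
  finally show ?thesis .
qed

text \<open>As m^d \<le> n^(3/4), the mean number n / m^d of points per cell is at least n^(1/4).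
  The union bound is thus at most n^(3/4) exp (- n^(1/4)), eventually below 1 / n^2.\<close>

lemma summable_missed:
  "summable (\<lambda>n. measure sample_space
     (\<Union>j\<in>grid (mesh CARD('d) n). missed n (mesh CARD('d) n) (j :: 'd::finite \<Rightarrow> nat)))"
    (is "summable ?f")
proof (rule summable_comparison_test_ev)
  let ?d = "CARD('d)"
  have le: "?f n \<le> real n powr (3/4) * exp (- (real n powr (1/4)))" if n: "0 < n" for n
  proof -
    let ?m = "mesh ?d n"
    have m: "real ?m ^ ?d \<le> real n powr (3/4)" by (rule mesh_power_le) (use n in auto)
    have m0: "0 < real ?m ^ ?d" using mesh_pos[OF n] by simp
    have "real n powr (1/4) = real n / real n powr (3/4)"
      using n powr_diff[of "real n" 1 "3/4"] by simp
    also have "\<dots> \<le> real n / real ?m ^ ?d" using m m0 n by (intro divide_left_mono mult_pos_pos) auto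
    finally have ex: "exp (- real n / real ?m ^ ?d) \<le> exp (- (real n powr (1/4)))" by simp
    have "?f n \<le> real ?m ^ ?d * exp (- real n / real ?m ^ ?d)"
      by (rule missed_union_measure_le[OF mesh_pos[OF n]])
    also have "\<dots> \<le> real n powr (3/4) * exp (- (real n powr (1/4)))"
      by (rule mult_mono[OF m ex]) simp_all
    finally show ?thesis .
  qed
  have "\<forall>\<^sub>F n in sequentially. real n powr (3/4) * exp (- (real n powr (1/4))) \<le> 1 / real n ^ 2"
    by real_asymp
  then show "\<forall>\<^sub>F n in sequentially. norm (?f n) \<le> 1 / real n ^ 2"
    using eventually_gt_at_top[of 0]
  proof eventually_elim
    case (elim n)
    have "norm (?f n) = ?f n" by (simp only: real_norm_def abs_of_nonneg[OF measure_nonneg])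
    also have "\<dots> \<le> 1 / real n ^ 2" using le[OF elim(2)] elim(1) by (rule order_trans)
    finally show ?case .
  qed
  show "summable (\<lambda>n. 1 / real n ^ 2)" using inverse_power_summable[of 2, where 'a = real] by (simp add: divide_inverse)
qed

lemma AE_not_missed:
  "AE X in sample_space. \<forall>\<^sub>F n in sequentially. X \<in> space sample_space -
     (\<Union>j\<in>grid (mesh CARD('d) n). missed n (mesh CARD('d) n) (j :: 'd::finite \<Rightarrow> nat))"
proof -
  interpret P: prob_space "sample_space :: (nat \<Rightarrow> 'd point) measure"
    by (rule prob_space_sample)
  have sets: "(\<Union>j\<in>grid (mesh CARD('d) n). missed n (mesh CARD('d) n) (j :: 'd \<Rightarrow> nat)) \<in> sets sample_space"
    for n
  \<comment> \<open>\<open>mesh\<close> vanishes only at n = 0, where the grid is empty and so is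
    the union.\<close>
  proof (cases "mesh CARD('d) n = 0")
    case False
    then show ?thesis
      by (intro sets.finite_UN missed_sets finite_PiE) auto
  qed simp
  show ?thesis
    by (rule borel_cantelli_AE1[OF sets _ summable_missed]) (simp add: P.emeasure_eq_measure)
qed

text \<open>The right-hand side is half of delta_n r_n. As sqrt n r_n^(2d) is eventually at least 1,
  r_n^2 is at least n^(-2b) with b = 1/(4d), while \<open>mesh d n\<close> is about n^(3b); their
  product, at least of order n^b, beats sqrt (log n).\<close>

lemma mesh_fine:
  fixes r :: "nat \<Rightarrow> real"
  assumes d: "0 < d" and r: "\<And>n. r n > 0"
    and lim: "filterlim (\<lambda>n. sqrt (real n) * r n ^ (2 * d) / ln (real n)) at_top sequentially"
  shows "\<forall>\<^sub>F n in sequentially. real d / real (mesh d n) < (r n)\<^sup>2 / (2 * sqrt (ln (real n)))"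
proof -
  define b where "b = 1 / (4 * real d)"
  have b: "0 < b" using d by (simp add: b_def)
  \<comment> \<open>The \<open>- 1\<close> absorbs the rounding in \<open>mesh\<close>.\<close>
  have "\<forall>\<^sub>F n in sequentially. 2 * real d * sqrt (ln (real n)) < real n powr b - 1"
    using b by real_asymp
  moreover have "\<forall>\<^sub>F n in sequentially. 1 \<le> sqrt (real n) * r n ^ (2 * d) / ln (real n)"
    using lim by (simp add: filterlim_at_top)
  moreover have "\<forall>\<^sub>F n in sequentially. 1 \<le> ln (real n)" by real_asymp
  ultimately show ?thesis using eventually_gt_at_top[of 0]
  proof eventually_elim
    case (elim n)
    let ?L = "sqrt (ln (real n))"
    have n: "1 \<le> real n" using elim(4) by simp
    have L: "0 < ?L" using elim(3) by simp
    have "1 \<le> sqrt (real n) * r n ^ (2 * d)"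
      using elim(2,3) by (simp add: field_simps)
    moreover have "(real n powr (- (2 * b))) ^ d * sqrt (real n) = 1"
      using d n by (simp add: b_def powr_powr powr_half_sqrt[symmetric] powr_add[symmetric] flip: powr_realpow)
    ultimately have "(real n powr (- (2 * b))) ^ d * sqrt (real n) \<le> ((r n)\<^sup>2) ^ d * sqrt (real n)"
      unfolding power_mult[symmetric] by (simp only: mult.commute[of "sqrt (real n)"])
    then have "(real n powr (- (2 * b))) ^ d \<le> ((r n)\<^sup>2) ^ d" using n by simp
    then have r2: "real n powr (- (2 * b)) \<le> (r n)\<^sup>2" using d by simp
    have p2: "1 \<le> real n powr (2 * b)" using n b by (simp add: ge_one_powr_ge_zero)
    have "2 * real d * ?L * real n powr (2 * b) < (real n powr b - 1) * real n powr (2 * b)"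
      using elim(1,4) p2 by (intro mult_strict_right_mono) auto
    also have "\<dots> = real n powr (3 * b) - real n powr (2 * b)"
      by (simp add: algebra_simps powr_add[symmetric])
    also have "\<dots> \<le> real n powr (3 * b) - 1" using p2 by simp
    also have "\<dots> \<le> real (mesh d n)" unfolding mesh_def b_def by simp
    finally have m: "2 * real d * ?L * real n powr (2 * b) < real (mesh d n)" .
    then have m0: "0 < real (mesh d n)" using mesh_pos[of n d] n by simp
    have "2 * real d * ?L < real (mesh d n) * real n powr (- (2 * b))"
      using m n by (simp add: powr_minus field_simps)
    also have "\<dots> \<le> real (mesh d n) * (r n)\<^sup>2" using r2 by (intro mult_left_mono) auto
    finally show ?case using m0 L by (simp add: field_simps)
  qed
qed


section \<open>The Dynamic Programming Principle\<close>

theorem theorem1: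
  fixes D :: "'d::{finite,linorder} point set"
    and f :: "'d point \<Rightarrow> real"
    and r \<delta> :: "nat \<Rightarrow> real"
  assumes "CARD('d) \<ge> 2"
    and "D \<subseteq> cbox 0 1" and "open D" and "strictly_convex_set D" and "closure D \<subseteq> box 0 1"
    and "bounded (f ` (cbox 0 1 - D))"
    and "\<And>n. r n > 0" and "decseq r" and "r \<longlonglongrightarrow> 0"
    and "filterlim (\<lambda>n. sqrt (real n) * r n ^ (2 * CARD('d)) / ln (real n)) at_top sequentially"
    and "\<And>n. \<delta> n = r n / sqrt (ln (real n))"
  shows "AE X in sample_space. \<forall>\<^sub>F n in sequentially.
           satisfies_DPP (points X n) (r n) (\<delta> n) D f (game_value (points X n) (r n) (\<delta> n) D f) \<and>
           (\<forall>u. satisfies_DPP (points X n) (r n) (\<delta> n) D f u \<longrightarrow>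
             (\<forall>x\<in>largest_component (points X n) (r n).
                u x = game_value (points X n) (r n) (\<delta> n) D f x))"
proof -
  let ?d = "CARD('d)"
  \<comment> \<open>A positive margin around \<open>D\<close> keeps balls of radius r_n centred in
    \<open>D\<close> inside the cube for large n, as \<open>reflection_progress\<close>
    requires.\<close>
  have "compact (closure D)"
    using assms(5) bounded_box bounded_subset by (metis closed_closure compact_eq_bounded_closed)
  then obtain \<epsilon> where \<epsilon>: "0 < \<epsilon>" "(\<Union>x\<in>closure D. cball x \<epsilon>) \<subseteq> box 0 1"
    using compact_subset_open_imp_cball_epsilon_subset[OF _ open_box assms(5)] by metis
  have small: "\<forall>\<^sub>F n in sequentially. r n < min (1/2) \<epsilon>"
    using assms(9) by (rule order_tendstoD) (use \<epsilon>(1) in simp)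
  \<comment> \<open>The bound 1 yields delta_n \<le> r_n \<le> 1/2; the bound 4 d yields
    \<open>4 * K * \<delta> \<le> r\<close> with K = d, an l1 bound for the norm on the
    cube.\<close>
  have log_large: "\<forall>\<^sub>F n in sequentially. max 1 (4 * real ?d) < sqrt (ln (real n))"
  proof -
    have "filterlim (\<lambda>n. sqrt (ln (real n))) at_top sequentially" by real_asymp
    then show ?thesis unfolding filterlim_at_top_dense by blast
  qed
  have fine: "\<forall>\<^sub>F n in sequentially. real ?d / real (mesh ?d n) < (r n)\<^sup>2 / (2 * sqrt (ln (real n)))"
    by (rule mesh_fine[OF _ assms(7,10)]) simp
  show ?thesis
    using AE_not_missed
  proof eventually_elim
    case (elim X)
    from elim small log_large fine eventually_gt_at_top[of 0] show ?case
    proof eventually_elim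
      case (elim n)
      let ?L = "sqrt (ln (real n))"
      have L: "1 < ?L" "4 * real ?d < ?L" using elim(3) by simp_all
      have r: "0 < r n" "r n \<le> 1/2" "r n < \<epsilon>" using assms(7) elim(2) by simp_all
      have pos: "0 < \<delta> n" and eq: "?L * \<delta> n = r n" using r(1) L(1) by (simp_all add: assms(11))
      have \<delta>: "\<delta> n \<le> 1/2" "4 * real ?d * \<delta> n \<le> r n"
        using mult_right_mono[of 1 ?L "\<delta> n"] mult_right_mono[of "4 * real ?d" ?L "\<delta> n"] pos eq L r(2)
        by linarith+
      have X: "X \<in> space sample_space" using elim(1) by blast
      have "reflection_game (points X n) (r n) (\<delta> n) D"
      proof (rule dense_reflection_game)
        fix p :: "'d point" assume "p \<in> cbox 0 1"
        then obtain z where z: "z \<in> points X n" "norm (z - p) \<le> real ?d / real (mesh ?d n)"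
          using not_missed_dense[OF elim(1) mesh_pos[OF elim(5)]] by blast
        moreover have "real ?d / real (mesh ?d n) < \<delta> n * r n / 2"
          using elim(4) by (simp add: assms(11) power2_eq_square)
        ultimately show "\<exists>z\<in>points X n. norm (z - p) < \<delta> n * r n / 2"
          by (intro bexI[of _ z] le_less_trans[OF z(2)]) auto
      next
        show "finite (points X n)" by (simp add: points_def)
        show "points X n \<subseteq> cbox 0 1" by (rule sample_space_points[OF X])
        fix x assume "x \<in> points X n"
        then have "\<bar>x $ i\<bar> \<le> 1" for i
          using sample_space_points[OF X] by (force simp: mem_box_cart)
        then have "(\<Sum>i\<in>UNIV. \<bar>x $ i\<bar>) \<le> (\<Sum>i\<in>(UNIV :: 'd set). 1)" by (intro sum_mono)
        then show "norm x \<le> real ?d" using norm_le_l1_cart[of x] by simp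
      next
        fix x assume "x \<in> D"
        then have "cball x \<epsilon> \<subseteq> box 0 1" using \<epsilon>(2) closure_subset[of D] by blast
        then show "cball x (r n) \<subseteq> cbox 0 1"
          using r(3) box_subset_cbox[of 0 "1 :: 'd point"] by (meson less_imp_le order_trans subset_cball)
      qed (use r pos \<delta> in auto)
      then interpret reflection_game "points X n" "r n" "\<delta> n" D f .
      show ?case using game_value_satisfies_DPP DPP_solution_eq_game_value by blast
    qed
  qed
qed

end
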